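(* Let $N$ be a finite set of players, let $M \subseteq N\times N$ be the set of all possible arcs, and let $S' \subseteq 2^M$ be a family of nonempty sets of arcs (the admissible subgraphs), with real incomes $D(S)$ for $S \in S'$ and weights $\alpha_x(S) \ge 0$ for $S\in S'$ and players $x \in S$ satisfying $\sum_{x\in S}\alpha_x(S)=1$ for each $S \in S'$. Suppose that any two distinct subgraphs from $S'$ do not intersect (i.e. have no common arc). Let $g$ be a network with arc set $M(g)\subseteq M$ and without loops. Then $g$ is stable if and only if $D(S)\ge 0$ for every $S \in S'(g)$.
   Context: A network $g$ is a directed graph whose vertex set is the finite set $N$ of players and whose arc set is $M(g) \subseteq M$. A subgraph $S\in S'$ is identified with its set of arcs; for a player $x \in N$, the notation $x\in S$ means that $x$ is an endpoint of some arc of $S$. For a network $g$, put $S'(g) = S'\cap 2^{M(g)} = \{M'\in S' \mid M'\subseteq M(g)\}$, the set of admissible subgraphs contained in $g$. The number $D(S)$ is the income produced by the subgraph $S$, and player $x\in S$ gets the share $\alpha_x(S)$ of it. The payoff of player $x$ in the network $g$ is $$H_x(g)=\sum_{S\in S'(g),\ x\in S}\alpha_x(S)D(S).$$ Links are formed by mutual agreement (an arc is present only if both of its endpoints request it), so a unilateral deviation of a player $x$ consists in breaking some of its links, i.e. deleting from $M(g)$ some set of arcs each of which has $x$ as an endpoint (incoming or outgoing). The network $g$ is stable if no player can increase its payoff by such a deviation: for every player $x\in N$ and every network $g'$ obtained from $g$ by deleting a set of arcs incident with $x$, $H_x(g')\le H_x(g)$. *)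

theory Defs
  imports Complex_Main "Graph_Theory.Pair_Digraph"
begin

text \<open>
  A subgraph is identified with its set of arcs \<open>S\<close>, so its set of players is \<open>Field S\<close>.
  The weight of player \<open>x\<close> in subgraph \<open>S\<close> is \<open>\<alpha> x S\<close>.
\<close>

definition admissible_in :: "'v rel set \<Rightarrow> 'v pair_pre_digraph \<Rightarrow> 'v rel set" where
  "admissible_in \<S> g = \<S> \<inter> Pow (parcs g)"

definition payoff ::
  "'v rel set \<Rightarrow> ('v \<Rightarrow> 'v rel \<Rightarrow> real) \<Rightarrow> ('v rel \<Rightarrow> real) \<Rightarrow> 'v \<Rightarrow> 'v pair_pre_digraph \<Rightarrow> real"
where
  "payoff \<S> \<alpha> D x g = (\<Sum>S | S \<in> admissible_in \<S> g \<and> x \<in> Field S. \<alpha> x S * D S)"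

definition incident_arcs :: "'v pair_pre_digraph \<Rightarrow> 'v \<Rightarrow> 'v rel" where
  "incident_arcs g x = in_arcs (with_proj g) x \<union> out_arcs (with_proj g) x"

text \<open>
  Forming a link needs the consent of both endpoints, so a unilateral deviation can only
  delete arcs; the vertex set is unchanged.
\<close>

definition stable_network ::
  "'v rel set \<Rightarrow> ('v \<Rightarrow> 'v rel \<Rightarrow> real) \<Rightarrow> ('v rel \<Rightarrow> real) \<Rightarrow> 'v pair_pre_digraph \<Rightarrow> bool"
where
  "stable_network \<S> \<alpha> D g \<longleftrightarrow>
    (\<forall>x \<in> pverts g. \<forall>A \<subseteq> incident_arcs g x.
      payoff \<S> \<alpha> D x (g\<lparr>parcs := parcs g - A\<rparr>) \<le> payoff \<S> \<alpha> D x g)"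

end

theory Submission
  imports Defs
begin

text \<open>
  A deletion of arcs destroys exactly the admissible subgraphs that it meets and creates none, so
  the deviating player loses precisely the shares earned in the destroyed subgraphs
  (\<open>payoff_delete_arcs\<close>). If all incomes are nonnegative, so are these shares, and no deviation
  pays. Conversely, if \<open>D S < 0\<close>, then some player \<open>x\<close> of \<open>S\<close> has a positive weight, because the
  weights of \<open>S\<close> add up to one; \<open>x\<close> can break a single arc of \<open>S\<close>. As distinct admissible
  subgraphs share no arc, this destroys \<open>S\<close> and nothing else, and \<open>x\<close> gets rid of a loss.
\<close>

lemma admissible_in_delete_arcs:
  "admissible_in \<S> (g\<lparr>parcs := parcs g - A\<rparr>) = {S \<in> admissible_in \<S> g. S \<inter> A = {}}"
  by (auto simp: admissible_in_def)

lemma finite_admissible_in: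
  assumes "finite (parcs g)"
  shows "finite (admissible_in \<S> g)"
  using assms by (simp add: admissible_in_def)

lemma mem_incident_arcs_iff:
  "a \<in> incident_arcs g x \<longleftrightarrow> a \<in> parcs g \<and> (fst a = x \<or> snd a = x)"
  by (auto simp: incident_arcs_def with_proj_def)

lemma payoff_delete_arcs:
  assumes "finite (parcs g)"
  shows "payoff \<S> \<alpha> D x g = payoff \<S> \<alpha> D x (g\<lparr>parcs := parcs g - A\<rparr>)
    + (\<Sum>S | S \<in> admissible_in \<S> g \<and> x \<in> Field S \<and> S \<inter> A \<noteq> {}. \<alpha> x S * D S)"
proof -
  let ?kept = "{S. S \<in> admissible_in \<S> (g\<lparr>parcs := parcs g - A\<rparr>) \<and> x \<in> Field S}"
  let ?lost = "{S. S \<in> admissible_in \<S> g \<and> x \<in> Field S \<and> S \<inter> A \<noteq> {}}"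
  have split: "{S. S \<in> admissible_in \<S> g \<and> x \<in> Field S} = ?kept \<union> ?lost"
    by (auto simp: admissible_in_delete_arcs)
  have "finite ?kept" "finite ?lost"
    using finite_admissible_in[OF assms, of \<S>] by (auto simp: admissible_in_delete_arcs)
  moreover have "?kept \<inter> ?lost = {}"
    by (auto simp: admissible_in_delete_arcs)
  ultimately show ?thesis
    unfolding payoff_def split by (rule sum.union_disjoint)
qed

lemma stable_network_if_incomes_nonneg:
  assumes "finite (parcs g)"
    and weights: "\<And>S x. S \<in> \<S> \<Longrightarrow> x \<in> Field S \<Longrightarrow> \<alpha> x S \<ge> 0"
    and incomes: "\<And>S. S \<in> admissible_in \<S> g \<Longrightarrow> D S \<ge> 0"
  shows "stable_network \<S> \<alpha> D g"
  unfolding stable_network_def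
proof (intro ballI allI impI)
  fix x A
  have "(\<Sum>S | S \<in> admissible_in \<S> g \<and> x \<in> Field S \<and> S \<inter> A \<noteq> {}. \<alpha> x S * D S) \<ge> 0"
    by (rule sum_nonneg) (auto simp: admissible_in_def intro!: mult_nonneg_nonneg weights incomes)
  then show "payoff \<S> \<alpha> D x (g\<lparr>parcs := parcs g - A\<rparr>) \<le> payoff \<S> \<alpha> D x g"
    using payoff_delete_arcs[OF assms(1), of \<S> \<alpha> D x A] by simp
qed

text \<open>
  Any arc of \<open>S\<close> at \<open>x\<close> identifies \<open>S\<close> among the pairwise disjoint admissible subgraphs, so its
  deletion costs \<open>x\<close> exactly the share in \<open>S\<close>; stability forbids this share to be a loss.
\<close>

lemma share_nonneg_if_stable_network:
  assumes "finite (parcs g)"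
    and disjoint: "\<And>S T. S \<in> \<S> \<Longrightarrow> T \<in> \<S> \<Longrightarrow> S \<noteq> T \<Longrightarrow> S \<inter> T = {}"
    and stable: "stable_network \<S> \<alpha> D g"
    and S: "S \<in> admissible_in \<S> g"
    and x: "x \<in> Field S" "x \<in> pverts g"
  shows "\<alpha> x S * D S \<ge> 0"
proof -
  obtain a where a: "a \<in> S" "fst a = x \<or> snd a = x"
    using x(1) by (force simp: Field_def)
  have "{a} \<subseteq> incident_arcs g x"
    using a S by (auto simp: mem_incident_arcs_iff admissible_in_def)
  then have "payoff \<S> \<alpha> D x (g\<lparr>parcs := parcs g - {a}\<rparr>) \<le> payoff \<S> \<alpha> D x g"
    using stable x(2) unfolding stable_network_def by blast
  moreover have "{T. T \<in> admissible_in \<S> g \<and> x \<in> Field T \<and> T \<inter> {a} \<noteq> {}} = {S}"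
    using S a(1) x(1) disjoint by (auto simp: admissible_in_def)
  ultimately show ?thesis
    using payoff_delete_arcs[OF assms(1), of \<S> \<alpha> D x "{a}"] by simp
qed

theorem proposition2p1:
  fixes N :: "'v set" and M :: "'v rel" and \<S> :: "'v rel set"
    and D :: "'v rel \<Rightarrow> real" and \<alpha> :: "'v \<Rightarrow> 'v rel \<Rightarrow> real"
    and g :: "'v pair_pre_digraph"
  assumes "finite N"
    and "M \<subseteq> N \<times> N"
    and "\<S> \<subseteq> Pow M"
    and "{} \<notin> \<S>"
    and "\<And>S x. S \<in> \<S> \<Longrightarrow> x \<in> Field S \<Longrightarrow> \<alpha> x S \<ge> 0"
    and "\<And>S. S \<in> \<S> \<Longrightarrow> (\<Sum>x\<in>Field S. \<alpha> x S) = 1"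
    and "\<And>S T. S \<in> \<S> \<Longrightarrow> T \<in> \<S> \<Longrightarrow> S \<noteq> T \<Longrightarrow> S \<inter> T = {}"
    and "pverts g = N"
    and "parcs g \<subseteq> M"
    and "pair_loopfree_digraph g"
  shows "stable_network \<S> \<alpha> D g \<longleftrightarrow> (\<forall>S \<in> admissible_in \<S> g. D S \<ge> 0)"
proof
  have arcs: "parcs g \<subseteq> N \<times> N"
    using assms(2,9) by blast
  then have fin: "finite (parcs g)"
    using assms(1) by (meson finite_SigmaI finite_subset)
  show "stable_network \<S> \<alpha> D g" if "\<forall>S \<in> admissible_in \<S> g. D S \<ge> 0"
    using that by (intro stable_network_if_incomes_nonneg fin assms(5)) auto
  show "\<forall>S \<in> admissible_in \<S> g. D S \<ge> 0" if stable: "stable_network \<S> \<alpha> D g"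
  proof
    fix S assume S: "S \<in> admissible_in \<S> g"
    then have S_mem: "S \<in> \<S>" and "S \<subseteq> N \<times> N"
      using arcs by (auto simp: admissible_in_def)
    then have players: "Field S \<subseteq> N"
      by (auto simp: Field_def)
    obtain x where x: "x \<in> Field S" "\<alpha> x S > 0"
      using sum_nonpos[of "Field S" "\<lambda>x. \<alpha> x S"] assms(6)[OF S_mem] by force
    have "\<alpha> x S * D S \<ge> 0"
      using share_nonneg_if_stable_network[OF fin assms(7) stable S x(1)] players x(1) assms(8)
      by blast
    then show "D S \<ge> 0"
      using x(2) by (simp add: zero_le_mult_iff)
  qed
qed

end
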